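(* Let $(V,\sigma_V)$ be a braided (resp. weakly braided) object in a symmetric category $(\mathcal{C},\otimes,\mathbf{I},c)$. Then $$\sigma'_V:=c_{V,V}\circ\sigma_V\circ c_{V,V}$$ is another specific (resp. weak) braiding on $V$.
   Context: All monoidal categories are strict; a symmetric category is a strict symmetric monoidal category. A weak braiding on an object $V$ is a morphism $\sigma:V\otimes V\to V\otimes V$ satisfying the Yang-Baxter equation $(\sigma\otimes\operatorname{Id}_V)(\operatorname{Id}_V\otimes\sigma)(\sigma\otimes\operatorname{Id}_V)=(\operatorname{Id}_V\otimes\sigma)(\sigma\otimes\operatorname{Id}_V)(\operatorname{Id}_V\otimes\sigma)$; a specific braiding is an invertible weak braiding. A weakly braided (resp. braided) object is an object endowed with a weak (resp. specific) braiding. *)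

theory Defs
  imports Main
begin

record ('o, 'm) category =
  obj :: "'o set"
  arr :: "'m set"
  src :: "'m \<Rightarrow> 'o"
  tgt :: "'m \<Rightarrow> 'o"
  idn :: "'o \<Rightarrow> 'm" ("Id\<index>")
  cmp :: "'m \<Rightarrow> 'm \<Rightarrow> 'm" (infixl "\<cdot>\<index>" 70)

text \<open>Composition is in applicative order: \<open>g \<cdot> f\<close> means first \<open>f\<close>, then \<open>g\<close>. It is meaningful only
  when \<open>f\<close> and \<open>g\<close> are arrows with matching target and source; nothing is assumed about other
  arguments, nor about the remaining operations outside of \<open>obj\<close> and \<open>arr\<close>.\<close>

definition hom :: "('o, 'm, 'x) category_scheme \<Rightarrow> 'o \<Rightarrow> 'o \<Rightarrow> 'm set"
  where "hom C A B = {f \<in> arr C. src C f = A \<and> tgt C f = B}"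

locale category =
  fixes C :: "('o, 'm, 'x) category_scheme" (structure)
  assumes src_obj: "f \<in> arr C \<Longrightarrow> src C f \<in> obj C"
    and tgt_obj: "f \<in> arr C \<Longrightarrow> tgt C f \<in> obj C"
    and id_hom: "A \<in> obj C \<Longrightarrow> Id A \<in> hom C A A"
    and comp_hom: "\<lbrakk>f \<in> hom C A B; g \<in> hom C B D\<rbrakk> \<Longrightarrow> g \<cdot> f \<in> hom C A D"
    and comp_id_right: "f \<in> hom C A B \<Longrightarrow> f \<cdot> Id A = f"
    and comp_id_left: "f \<in> hom C A B \<Longrightarrow> Id B \<cdot> f = f"
    and comp_assoc: "\<lbrakk>f \<in> hom C A B; g \<in> hom C B D; h \<in> hom C D E\<rbrakk>
      \<Longrightarrow> (h \<cdot> g) \<cdot> f = h \<cdot> (g \<cdot> f)"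

definition invertible :: "('o, 'm, 'x) category_scheme \<Rightarrow> 'm \<Rightarrow> bool"
  where "invertible C f \<longleftrightarrow> f \<in> arr C \<and>
    (\<exists>g \<in> hom C (tgt C f) (src C f).
      g \<cdot>\<^bsub>C\<^esub> f = Id\<^bsub>C\<^esub> (src C f) \<and> f \<cdot>\<^bsub>C\<^esub> g = Id\<^bsub>C\<^esub> (tgt C f))"

record ('o, 'm) monoidal_category = "('o, 'm) category" +
  tensor_obj :: "'o \<Rightarrow> 'o \<Rightarrow> 'o" (infixr "\<otimes>\<^sub>o\<index>" 75)
  tensor_arr :: "'m \<Rightarrow> 'm \<Rightarrow> 'm" (infixr "\<otimes>\<index>" 75)
  unit_obj :: "'o" ("\<I>\<index>")

locale strict_monoidal_category = category C
  for C :: "('o, 'm, 'x) monoidal_category_scheme" (structure) +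
  assumes unit_obj: "\<I> \<in> obj C"
    and tensor_obj_closed: "\<lbrakk>A \<in> obj C; B \<in> obj C\<rbrakk> \<Longrightarrow> A \<otimes>\<^sub>o B \<in> obj C"
    and tensor_hom: "\<lbrakk>f \<in> hom C A B; g \<in> hom C A' B'\<rbrakk> \<Longrightarrow> f \<otimes> g \<in> hom C (A \<otimes>\<^sub>o A') (B \<otimes>\<^sub>o B')"
    and tensor_id: "\<lbrakk>A \<in> obj C; B \<in> obj C\<rbrakk> \<Longrightarrow> Id A \<otimes> Id B = Id (A \<otimes>\<^sub>o B)"
    and interchange: "\<lbrakk>f \<in> hom C A B; g \<in> hom C B D; f' \<in> hom C A' B'; g' \<in> hom C B' D'\<rbrakk>
      \<Longrightarrow> (g \<cdot> f) \<otimes> (g' \<cdot> f') = (g \<otimes> g') \<cdot> (f \<otimes> f')"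
    and tensor_obj_assoc: "\<lbrakk>A \<in> obj C; B \<in> obj C; D \<in> obj C\<rbrakk>
      \<Longrightarrow> (A \<otimes>\<^sub>o B) \<otimes>\<^sub>o D = A \<otimes>\<^sub>o (B \<otimes>\<^sub>o D)"
    and tensor_obj_unit_left: "A \<in> obj C \<Longrightarrow> \<I> \<otimes>\<^sub>o A = A"
    and tensor_obj_unit_right: "A \<in> obj C \<Longrightarrow> A \<otimes>\<^sub>o \<I> = A"
    and tensor_arr_assoc: "\<lbrakk>f \<in> arr C; g \<in> arr C; h \<in> arr C\<rbrakk>
      \<Longrightarrow> (f \<otimes> g) \<otimes> h = f \<otimes> (g \<otimes> h)"
    and tensor_arr_unit_left: "f \<in> arr C \<Longrightarrow> Id \<I> \<otimes> f = f"
    and tensor_arr_unit_right: "f \<in> arr C \<Longrightarrow> f \<otimes> Id \<I> = f"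

record ('o, 'm) symmetric_category = "('o, 'm) monoidal_category" +
  symm :: "'o \<Rightarrow> 'o \<Rightarrow> 'm" ("\<c>\<index>")

text \<open>No unit axiom is needed: the hexagon \<open>\<c> A (\<I> \<otimes> \<I>)\<close> gives \<open>\<c> A \<I> = \<c> A \<I> \<cdot> \<c> A \<I>\<close>, and \<open>\<c> A \<I>\<close>
  is invertible by \<open>symm_involutive\<close>, so \<open>\<c> A \<I> = Id A\<close>.\<close>

locale symmetric_category = strict_monoidal_category C
  for C :: "('o, 'm, 'x) symmetric_category_scheme" (structure) +
  assumes symm_hom: "\<lbrakk>A \<in> obj C; B \<in> obj C\<rbrakk> \<Longrightarrow> \<c> A B \<in> hom C (A \<otimes>\<^sub>o B) (B \<otimes>\<^sub>o A)"
    and symm_natural: "\<lbrakk>f \<in> hom C A B; g \<in> hom C A' B'\<rbrakk>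
      \<Longrightarrow> \<c> B B' \<cdot> (f \<otimes> g) = (g \<otimes> f) \<cdot> \<c> A A'"
    and hexagon_left: "\<lbrakk>A \<in> obj C; B \<in> obj C; D \<in> obj C\<rbrakk>
      \<Longrightarrow> \<c> (A \<otimes>\<^sub>o B) D = (\<c> A D \<otimes> Id B) \<cdot> (Id A \<otimes> \<c> B D)"
    and hexagon_right: "\<lbrakk>A \<in> obj C; B \<in> obj C; D \<in> obj C\<rbrakk>
      \<Longrightarrow> \<c> A (B \<otimes>\<^sub>o D) = (Id B \<otimes> \<c> A D) \<cdot> (\<c> A B \<otimes> Id D)"
    and symm_involutive: "\<lbrakk>A \<in> obj C; B \<in> obj C\<rbrakk> \<Longrightarrow> \<c> B A \<cdot> \<c> A B = Id (A \<otimes>\<^sub>o B)"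

definition weak_braiding :: "('o, 'm, 'x) monoidal_category_scheme \<Rightarrow> 'o \<Rightarrow> 'm \<Rightarrow> bool"
  where "weak_braiding C V \<sigma> \<longleftrightarrow>
    \<sigma> \<in> hom C (V \<otimes>\<^sub>o\<^bsub>C\<^esub> V) (V \<otimes>\<^sub>o\<^bsub>C\<^esub> V) \<and>
    (\<sigma> \<otimes>\<^bsub>C\<^esub> Id\<^bsub>C\<^esub> V) \<cdot>\<^bsub>C\<^esub> (Id\<^bsub>C\<^esub> V \<otimes>\<^bsub>C\<^esub> \<sigma>) \<cdot>\<^bsub>C\<^esub> (\<sigma> \<otimes>\<^bsub>C\<^esub> Id\<^bsub>C\<^esub> V) =
    (Id\<^bsub>C\<^esub> V \<otimes>\<^bsub>C\<^esub> \<sigma>) \<cdot>\<^bsub>C\<^esub> (\<sigma> \<otimes>\<^bsub>C\<^esub> Id\<^bsub>C\<^esub> V) \<cdot>\<^bsub>C\<^esub> (Id\<^bsub>C\<^esub> V \<otimes>\<^bsub>C\<^esub> \<sigma>)"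

definition specific_braiding :: "('o, 'm, 'x) monoidal_category_scheme \<Rightarrow> 'o \<Rightarrow> 'm \<Rightarrow> bool"
  where "specific_braiding C V \<sigma> \<longleftrightarrow> weak_braiding C V \<sigma> \<and> invertible C \<sigma>"

definition weakly_braided_object :: "('o, 'm, 'x) monoidal_category_scheme \<Rightarrow> 'o \<Rightarrow> 'm \<Rightarrow> bool"
  where "weakly_braided_object C V \<sigma> \<longleftrightarrow> V \<in> obj C \<and> weak_braiding C V \<sigma>"

definition braided_object :: "('o, 'm, 'x) monoidal_category_scheme \<Rightarrow> 'o \<Rightarrow> 'm \<Rightarrow> bool"
  where "braided_object C V \<sigma> \<longleftrightarrow> V \<in> obj C \<and> specific_braiding C V \<sigma>"

end

theory Submission imports Defs begin

text \<open>On \<open>V \<otimes> V \<otimes> V\<close> write \<open>s\<^sub>1 = \<sigma> \<otimes> Id\<close>, \<open>s\<^sub>2 = Id \<otimes> \<sigma>\<close>, and likewise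
  \<open>c\<^sub>1, c\<^sub>2\<close> for \<open>c = c\<^sub>V\<^sub>,\<^sub>V\<close> and \<open>s\<^sub>1', s\<^sub>2'\<close> for \<open>\<sigma>' = c \<sigma> c\<close>. By the hexagons, naturality of the
  symmetry reads \<open>c\<^sub>1 c\<^sub>2 f\<^sub>1 = f\<^sub>2 c\<^sub>1 c\<^sub>2\<close> and \<open>c\<^sub>2 c\<^sub>1 f\<^sub>2 = f\<^sub>1 c\<^sub>2 c\<^sub>1\<close> for every endomorphism \<open>f\<close> of
  \<open>V \<otimes> V\<close>. Hence the involution \<open>w = c\<^sub>1 c\<^sub>2 c\<^sub>1 = c\<^sub>2 c\<^sub>1 c\<^sub>2\<close> satisfies \<open>w s\<^sub>1' = s\<^sub>2 w\<close> and
  \<open>w s\<^sub>2' = s\<^sub>1 w\<close>: conjugation by \<open>w\<close> turns the Yang-Baxter equation of \<open>\<sigma>'\<close> into that of \<open>\<sigma>\<close>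
  with the two sides exchanged.\<close>

context category
begin

lemma endo_comp: "\<lbrakk>f \<in> hom C X X; g \<in> hom C X X\<rbrakk> \<Longrightarrow> g \<cdot> f \<in> hom C X X"
  by (rule comp_hom)

text \<open>Restricting to one object leaves only \<open>X\<close> to instantiate when rewriting;
  the four objects of \<open>comp_assoc\<close> cannot be read off the composite.\<close>

lemma endo_assoc:
  "\<lbrakk>f \<in> hom C X X; g \<in> hom C X X; h \<in> hom C X X\<rbrakk> \<Longrightarrow> h \<cdot> g \<cdot> f = h \<cdot> (g \<cdot> f)"
  by (rule comp_assoc)

text \<open>Moves \<open>w\<close> past one factor at a time; meant for the triple products in a
  Yang-Baxter equation.\<close>

lemma intertwine_comp3:
  assumes hom: "w \<in> hom C X X" "x \<in> hom C X X" "y \<in> hom C X X" "z \<in> hom C X X"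
      "x' \<in> hom C X X" "y' \<in> hom C X X" "z' \<in> hom C X X"
    and inter: "w \<cdot> x = x' \<cdot> w" "w \<cdot> y = y' \<cdot> w" "w \<cdot> z = z' \<cdot> w"
  shows "w \<cdot> (x \<cdot> y \<cdot> z) = x' \<cdot> y' \<cdot> z' \<cdot> w"
proof -
  have "w \<cdot> (x \<cdot> y \<cdot> z) = (w \<cdot> x) \<cdot> (y \<cdot> z)"
    using hom by (simp add: endo_assoc[of _ X] endo_comp)
  also have "\<dots> = x' \<cdot> ((w \<cdot> y) \<cdot> z)"
    unfolding inter(1) using hom by (simp add: endo_assoc[of _ X] endo_comp)
  also have "\<dots> = x' \<cdot> (y' \<cdot> (w \<cdot> z))"
    unfolding inter(2) using hom by (simp add: endo_assoc[of _ X] endo_comp)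
  also have "\<dots> = x' \<cdot> y' \<cdot> z' \<cdot> w"
    unfolding inter(3) using hom by (simp add: endo_assoc[of _ X] endo_comp)
  finally show ?thesis .
qed

lemma left_cancel:
  assumes "w \<in> hom C X X" "w' \<in> hom C X X" "w' \<cdot> w = Id X" "f \<in> hom C X X" "g \<in> hom C X X"
    and "w \<cdot> f = w \<cdot> g"
  shows "f = g"
proof -
  have "f = w' \<cdot> (w \<cdot> f)" using assms by (metis comp_assoc comp_id_left)
  also have "\<dots> = g" using assms by (metis comp_assoc comp_id_left)
  finally show ?thesis .
qed

lemma involution_cancel:
  "\<lbrakk>u \<in> hom C X X; u \<cdot> u = Id X; f \<in> hom C X X\<rbrakk> \<Longrightarrow> u \<cdot> (u \<cdot> f) = f"
  by (metis comp_assoc comp_id_left)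

text \<open>Moving \<open>w\<close> to the right turns \<open>x \<cdot> y \<cdot> x\<close> into
  \<open>b \<cdot> a \<cdot> b\<close> and \<open>y \<cdot> x \<cdot> y\<close> into
  \<open>a \<cdot> b \<cdot> a\<close>; these agree, and \<open>w\<close> cancels on the
  left.\<close>

lemma braid_relation_transport:
  assumes hom: "w \<in> hom C X X" "w' \<in> hom C X X" "x \<in> hom C X X" "y \<in> hom C X X"
      "a \<in> hom C X X" "b \<in> hom C X X"
    and "w' \<cdot> w = Id X" "w \<cdot> x = b \<cdot> w" "w \<cdot> y = a \<cdot> w"
    and "a \<cdot> b \<cdot> a = b \<cdot> a \<cdot> b"
  shows "x \<cdot> y \<cdot> x = y \<cdot> x \<cdot> y"
proof (rule left_cancel[of w X w'])
  show "w \<cdot> (x \<cdot> y \<cdot> x) = w \<cdot> (y \<cdot> x \<cdot> y)"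
    using assms by (simp add: intertwine_comp3[of w X x y x b a b] intertwine_comp3[of w X y x y a b a])
qed (use assms in \<open>simp_all add: endo_comp\<close>)

text \<open>If \<open>g\<close> is inverse to \<open>f\<close>, then
  \<open>u \<cdot> g \<cdot> u\<close> is inverse to the conjugate, since the inner pair of
  \<open>u\<close> cancels.\<close>

lemma invertible_conj_involution:
  assumes "u \<in> hom C X X" "u \<cdot> u = Id X" "f \<in> hom C X X" "invertible C f"
  shows "invertible C (u \<cdot> f \<cdot> u)"
proof -
  obtain g where g: "g \<in> hom C X X" "g \<cdot> f = Id X" "f \<cdot> g = Id X"
    using assms by (auto simp: invertible_def hom_def)
  have X: "X \<in> obj C" using assms(1) src_obj by (auto simp: hom_def)
  have conj: "(u \<cdot> h \<cdot> u) \<cdot> (u \<cdot> k \<cdot> u) = Id X"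
    if "h \<in> hom C X X" "k \<in> hom C X X" "h \<cdot> k = Id X" for h k
  proof -
    have "(u \<cdot> h \<cdot> u) \<cdot> (u \<cdot> k \<cdot> u) = u \<cdot> ((h \<cdot> k) \<cdot> u)"
      using assms(1-3) that(1,2)
      by (simp add: endo_assoc[of _ X] endo_comp involution_cancel[of _ X])
    then show ?thesis using assms that by (simp add: comp_id_left)
  qed
  have "u \<cdot> f \<cdot> u \<in> hom C X X" "u \<cdot> g \<cdot> u \<in> hom C X X"
    using assms g by (simp_all add: endo_comp)
  then show ?thesis
    using conj[of g f] conj[of f g] g assms(3)
    unfolding invertible_def by (auto simp: hom_def)
qed

end

context strict_monoidal_category
begin

text \<open>Interchange, with \<open>Id E\<close> written as
  \<open>Id E \<cdot> Id E\<close>.\<close>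

lemma tensor_comp_id:
  assumes "f \<in> hom C A B" "g \<in> hom C B D" "E \<in> obj C"
  shows "(g \<cdot> f) \<otimes> Id E = (g \<otimes> Id E) \<cdot> (f \<otimes> Id E)"
  using interchange[OF assms(1,2) id_hom id_hom] assms(3) by (metis comp_id_left id_hom)

lemma id_tensor_comp:
  assumes "f \<in> hom C A B" "g \<in> hom C B D" "E \<in> obj C"
  shows "Id E \<otimes> (g \<cdot> f) = (Id E \<otimes> g) \<cdot> (Id E \<otimes> f)"
  using interchange[OF id_hom id_hom assms(1,2)] assms(3) by (metis comp_id_left id_hom)

end

context symmetric_category
begin

lemma weak_braiding_conj_symm:
  assumes V: "V \<in> obj C" and wb: "weak_braiding C V \<sigma>"
  shows "weak_braiding C V (\<c> V V \<cdot> \<sigma> \<cdot> \<c> V V)"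
proof -
  let ?W = "V \<otimes>\<^sub>o V" and ?X = "V \<otimes>\<^sub>o V \<otimes>\<^sub>o V"
  let ?c = "\<c> V V" and ?\<sigma>' = "\<c> V V \<cdot> \<sigma> \<cdot> \<c> V V"
  define l r where "l f = f \<otimes> Id V" and "r f = Id V \<otimes> f" for f
  have W: "?W \<in> obj C" and XW: "?W \<otimes>\<^sub>o V = ?X"
    using V by (simp_all add: tensor_obj_closed tensor_obj_assoc)
  have c: "?c \<in> hom C ?W ?W" and \<sigma>: "\<sigma> \<in> hom C ?W ?W"
    and yb: "l \<sigma> \<cdot> r \<sigma> \<cdot> l \<sigma> = r \<sigma> \<cdot> l \<sigma> \<cdot> r \<sigma>"
    using V wb by (simp_all add: symm_hom weak_braiding_def l_def r_def)
  have \<sigma>': "?\<sigma>' \<in> hom C ?W ?W" using c \<sigma> by (simp add: endo_comp)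
  have l: "l f \<in> hom C ?X ?X" and r: "r f \<in> hom C ?X ?X" if "f \<in> hom C ?W ?W" for f
    using tensor_hom[OF that id_hom[OF V]] tensor_hom[OF id_hom[OF V] that] XW
    by (simp_all add: l_def r_def)
  have l_comp: "l (g \<cdot> f) = l g \<cdot> l f" and r_comp: "r (g \<cdot> f) = r g \<cdot> r f"
    if "f \<in> hom C ?W ?W" "g \<in> hom C ?W ?W" for f g
    using that V by (simp_all add: l_def r_def tensor_comp_id id_tensor_comp)
  have cc: "?c \<cdot> ?c = Id ?W" using V by (simp add: symm_involutive)
  have l_inv: "l ?c \<cdot> l ?c = Id ?X" and r_inv: "r ?c \<cdot> r ?c = Id ?X"
    using l_comp[OF c c] r_comp[OF c c] V W XW by (simp_all add: cc l_def r_def tensor_id)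
  \<comment> \<open>Naturality of the symmetry between \<open>?W\<close> and \<open>V\<close>: the
    hexagons factor \<open>\<c> ?W V\<close> as \<open>l ?c \<cdot> r ?c\<close> and
    \<open>\<c> V ?W\<close> as \<open>r ?c \<cdot> l ?c\<close>.\<close>
  have nat_l: "l ?c \<cdot> r ?c \<cdot> l f = r f \<cdot> (l ?c \<cdot> r ?c)"
    and nat_r: "r ?c \<cdot> l ?c \<cdot> r f = l f \<cdot> (r ?c \<cdot> l ?c)" if "f \<in> hom C ?W ?W" for f
    using symm_natural[OF that id_hom[OF V]] symm_natural[OF id_hom[OF V] that] V
    by (simp_all add: hexagon_left hexagon_right l_def r_def)
  define w where "w = l ?c \<cdot> r ?c \<cdot> l ?c"
  \<comment> \<open>This is \<open>nat_l\<close> for \<open>f = ?c\<close>: the symmetry itself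
    satisfies Yang-Baxter.\<close>
  have w_alt: "w = r ?c \<cdot> l ?c \<cdot> r ?c"
    unfolding w_def using nat_l[OF c] c by (simp add: endo_assoc[of _ ?X] endo_comp l r)
  have w: "w \<in> hom C ?X ?X" unfolding w_def using c by (simp add: endo_comp l r)
  have ww: "w \<cdot> w = Id ?X"
    unfolding w_def using c by (simp add: endo_assoc[of _ ?X] endo_comp l r l_inv
        involution_cancel[of _ ?X] r_inv)
  have wl: "w \<cdot> l ?\<sigma>' = r \<sigma> \<cdot> w"
  proof -
    \<comment> \<open>The last \<open>l ?c\<close> of \<open>w\<close> cancels the first one of
      \<open>l ?\<sigma>'\<close>.\<close>
    have "w \<cdot> l ?\<sigma>' = (l ?c \<cdot> r ?c \<cdot> l \<sigma>) \<cdot> l ?c"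
      unfolding w_def using c \<sigma>
      by (simp add: l_comp endo_assoc[of _ ?X] endo_assoc[of _ ?W] endo_comp[of _ ?X]
          endo_comp[of _ ?W] l r involution_cancel[of _ ?X] l_inv)
    also have "\<dots> = r \<sigma> \<cdot> w"
      unfolding nat_l[OF \<sigma>] w_def using c \<sigma> by (simp add: endo_assoc[of _ ?X] endo_comp l r)
    finally show ?thesis .
  qed
  have wr: "w \<cdot> r ?\<sigma>' = l \<sigma> \<cdot> w"
  proof -
    \<comment> \<open>Here the form \<open>w_alt\<close> is used, because it ends in
      \<open>r ?c\<close> and so cancels the first factor of \<open>r ?\<sigma>'\<close>.\<close>
    have "w \<cdot> r ?\<sigma>' = (r ?c \<cdot> l ?c \<cdot> r \<sigma>) \<cdot> r ?c"
      unfolding w_alt using c \<sigma>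
      by (simp add: r_comp endo_assoc[of _ ?X] endo_assoc[of _ ?W] endo_comp[of _ ?X]
          endo_comp[of _ ?W] l r involution_cancel[of _ ?X] r_inv)
    also have "\<dots> = l \<sigma> \<cdot> w"
      unfolding nat_r[OF \<sigma>] w_alt using c \<sigma> by (simp add: endo_assoc[of _ ?X] endo_comp l r)
    finally show ?thesis .
  qed
  have "l ?\<sigma>' \<cdot> r ?\<sigma>' \<cdot> l ?\<sigma>' = r ?\<sigma>' \<cdot> l ?\<sigma>' \<cdot> r ?\<sigma>'"
    by (rule braid_relation_transport[OF w w l[OF \<sigma>'] r[OF \<sigma>'] l[OF \<sigma>] r[OF \<sigma>] ww wl wr yb])
  with \<sigma>' show ?thesis by (simp add: weak_braiding_def l_def r_def)
qed

text \<open>Invertibility survives because \<open>\<c> V V\<close> is an involution, by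
  \<open>symm_involutive\<close>.\<close>

lemma specific_braiding_conj_symm:
  assumes V: "V \<in> obj C" and sb: "specific_braiding C V \<sigma>"
  shows "specific_braiding C V (\<c> V V \<cdot> \<sigma> \<cdot> \<c> V V)"
proof -
  have "weak_braiding C V \<sigma>" "invertible C \<sigma>" "\<sigma> \<in> hom C (V \<otimes>\<^sub>o V) (V \<otimes>\<^sub>o V)"
    using sb by (simp_all add: specific_braiding_def weak_braiding_def)
  then show ?thesis
    unfolding specific_braiding_def using V
    by (simp add: weak_braiding_conj_symm symm_hom symm_involutive
        invertible_conj_involution[of _ "V \<otimes>\<^sub>o V"])
qed

end

theorem theorem8:
  fixes C :: "('o, 'm, 'x) symmetric_category_scheme" and V :: 'o and \<sigma> :: 'm
  assumes "symmetric_category C"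
  shows "(braided_object C V \<sigma> \<longrightarrow>
            specific_braiding C V (\<c>\<^bsub>C\<^esub> V V \<cdot>\<^bsub>C\<^esub> \<sigma> \<cdot>\<^bsub>C\<^esub> \<c>\<^bsub>C\<^esub> V V))
       \<and> (weakly_braided_object C V \<sigma> \<longrightarrow>
            weak_braiding C V (\<c>\<^bsub>C\<^esub> V V \<cdot>\<^bsub>C\<^esub> \<sigma> \<cdot>\<^bsub>C\<^esub> \<c>\<^bsub>C\<^esub> V V))"
  using symmetric_category.specific_braiding_conj_symm[OF assms]
    symmetric_category.weak_braiding_conj_symm[OF assms]
  by (simp add: braided_object_def weakly_braided_object_def)

end
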